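(* The following statements hold. (i) There exist a set $\mathcal{X}$ and a class $\mathcal{F}\subseteq\mathcal{X}^{\mathcal{X}}$ such that $\operatorname{DS}(\mathcal{F})=\infty$ but $\operatorname{C}_T(\mathcal{F})=\Theta(\log T)$ as $T\to\infty$. (ii) There exist a set $\mathcal{X}$ and a class $\mathcal{F}\subseteq\mathcal{X}^{\mathcal{X}}$ such that $\operatorname{DS}(\mathcal{F})=1$ but $\operatorname{C}_T(\mathcal{F})=T$ for every $T\in\mathbb{N}$. (iii) For every non-empty set $\mathcal{X}$, every non-empty class $\mathcal{F}\subseteq\mathcal{X}^{\mathcal{X}}$ and every $T\in\mathbb{N}$, $\operatorname{C}_T(\mathcal{F})\le\operatorname{L}(\mathcal{F})$. (iv) There exist a set $\mathcal{X}$ and a class $\mathcal{F}\subseteq\mathcal{X}^{\mathcal{X}}$ such that $\operatorname{L}(\mathcal{F})=\infty$ but $\operatorname{C}_T(\mathcal{F})=1$ for every $T\in\mathbb{N}$.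
   Context: $\mathbb{N}=\{1,2,\dots\}$, $[d]=\{1,\dots,d\}$. For $\sigma\in\{-1,1\}^d$, write $\sigma_{\le t}=(\sigma_1,\dots,\sigma_t)$ and $\sigma_{<t}=(\sigma_1,\dots,\sigma_{t-1})$. Evolution complexity. A trajectory tree of depth $d$ is a sequence $\mathcal{T}=(\mathcal{T}_0,\dots,\mathcal{T}_d)$ with $\mathcal{T}_0\in\mathcal{X}$ and $\mathcal{T}_t:\{-1,1\}^t\to\mathcal{X}$ for $t\in[d]$. It is shattered by $\mathcal{F}$ if for every $\sigma\in\{-1,1\}^d$ there is $f_\sigma\in\mathcal{F}$ with $f_\sigma(\mathcal{T}_{t-1}(\sigma_{<t}))=\mathcal{T}_t(\sigma_{\le t})$ for all $t\in[d]$. Its branching factor is $\operatorname{B}(\mathcal{T}) := \min_{\sigma\in\{-1,1\}^d}\sum_{t=1}^d \mathbf{1}\{\mathcal{T}_t((\sigma_{<t},-1))\neq\mathcal{T}_t((\sigma_{<t},+1))\}$. Then $\operatorname{C}_d(\mathcal{F}) := \sup\{\operatorname{B}(\mathcal{T}) : \mathcal{T}\text{ is a trajectory tree of depth } d \text{ shattered by }\mathcal{F}\}$. DS dimension. A set $A\subseteq\mathcal{X}$ is DS-shattered by $\mathcal{F}$ if there is a non-empty finite $\mathcal{H}\subseteq\mathcal{F}$ such that for every $x\in A$ and $h\in\mathcal{H}$ there is $g\in\mathcal{H}$ with $g(x)\ne h(x)$ and $g(z)=h(z)$ for all $z\in A\setminus\{x\}$. $\operatorname{DS}(\mathcal{F})$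 is the largest $d$ for which some set of cardinality $d$ is DS-shattered, and $\operatorname{DS}(\mathcal{F})=\infty$ if arbitrarily large sets are DS-shattered. Littlestone dimension. Consider a complete binary tree of depth $d$ whose internal nodes are labeled by functions $\mathcal{T}_{t-1}:\{-1,1\}^{t-1}\to\mathcal{X}$, $t\in[d]$. It is (Littlestone-)shattered by $\mathcal{F}$ if there are edge-labeling functions $Y_t:\{-1,1\}^t\to\mathcal{X}$, $t\in[d]$, such that for every $\sigma\in\{-1,1\}^d$ there is $f_\sigma\in\mathcal{F}$ such that for all $t\in[d]$, $f_\sigma(\mathcal{T}_{t-1}(\sigma_{<t}))=Y_t(\sigma_{\le t})$ and $Y_t((\sigma_{<t},-1))\neq Y_t((\sigma_{<t},+1))$. $\operatorname{L}(\mathcal{F})$ is the maximal depth of a tree Littlestone-shattered by $\mathcal{F}$ ($0$ if there is none of positive depth, $\infty$ if there are such trees of arbitrarily large depth). *)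

theory Defs
  imports Complex_Main "HOL-Library.FuncSet" "HOL-Library.Extended_Nat" "HOL-Library.Landau_Symbols"
begin

text \<open>
  Sign vectors in \<open>{-1,1}^d\<close> are Boolean lists of length \<open>d\<close>, with \<open>False\<close> for \<open>-1\<close> and \<open>True\<close>
  for \<open>+1\<close>. Thus \<open>take t \<sigma>\<close> is the prefix \<open>\<sigma>\<^sub>1, \<dots>, \<sigma>\<^sub>t\<close>, and \<open>take (t - 1) \<sigma>\<close> is the strict
  prefix \<open>\<sigma>\<^sub>1, \<dots>, \<sigma>\<^sub>t\<^sub>-\<^sub>1\<close>.
  A family of maps \<open>\<T>\<^sub>t\<close>, each defined on \<open>{-1,1}^t\<close>, is a single function \<open>\<T>\<close> on lists: \<open>\<T>\<^sub>t\<close> is its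
  restriction to lists of length \<open>t\<close>, and its values on lists of irrelevant length are ignored.
  A class of self-maps of \<open>X\<close> is a set \<open>F \<subseteq> X \<rightarrow>\<^sub>E X\<close>.
\<close>

definition trajectory_tree :: "'a set \<Rightarrow> nat \<Rightarrow> (bool list \<Rightarrow> 'a) \<Rightarrow> bool" where
  "trajectory_tree X d \<T> \<longleftrightarrow> (\<forall>s. length s \<le> d \<longrightarrow> \<T> s \<in> X)"

definition trajectory_shattered :: "('a \<Rightarrow> 'a) set \<Rightarrow> nat \<Rightarrow> (bool list \<Rightarrow> 'a) \<Rightarrow> bool" where
  "trajectory_shattered F d \<T> \<longleftrightarrow>
     (\<forall>\<sigma>. length \<sigma> = d \<longrightarrow>
        (\<exists>f\<in>F. \<forall>t\<in>{1..d}. f (\<T> (take (t - 1) \<sigma>)) = \<T> (take t \<sigma>)))"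

definition branching_factor :: "nat \<Rightarrow> (bool list \<Rightarrow> 'a) \<Rightarrow> nat" where
  "branching_factor d \<T> =
     Min ((\<lambda>\<sigma>. \<Sum>t=1..d. of_bool (\<T> (take (t - 1) \<sigma> @ [False]) \<noteq> \<T> (take (t - 1) \<sigma> @ [True])))
          ` {\<sigma>. length \<sigma> = d})"

definition branching_factors :: "'a set \<Rightarrow> ('a \<Rightarrow> 'a) set \<Rightarrow> nat \<Rightarrow> nat set" where
  "branching_factors X F d =
     {branching_factor d \<T> | \<T>. trajectory_tree X d \<T> \<and> trajectory_shattered F d \<T>}"

lemma branching_factor_le: "branching_factor d \<T> \<le> d"
proof -
  let ?b = "\<lambda>\<sigma>. \<Sum>t=1..d. of_bool (\<T> (take (t - 1) \<sigma> @ [False]) \<noteq> \<T> (take (t - 1) \<sigma> @ [True])) :: nat"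
  have "finite {\<sigma> :: bool list. length \<sigma> = d}"
    using finite_lists_length_eq[of "UNIV :: bool set" d] by simp
  then have "branching_factor d \<T> \<le> ?b (replicate d True)"
    unfolding branching_factor_def by (intro Min_le finite_imageI imageI) simp_all
  also have "\<dots> \<le> (\<Sum>t=1..d. 1)"
    by (intro sum_mono) simp
  finally show ?thesis by simp
qed

text \<open>The supremum below is taken in \<^typ>\<open>nat\<close>, where \<open>Sup\<close> is meaningful only for bounded sets.\<close>

lemma bdd_above_branching_factors: "bdd_above (branching_factors X F d)"
  unfolding branching_factors_def
  by (intro bdd_aboveI[of _ d]) (auto simp: branching_factor_le)

definition evolution_complexity :: "'a set \<Rightarrow> ('a \<Rightarrow> 'a) set \<Rightarrow> nat \<Rightarrow> nat" where
  "evolution_complexity X F d = Sup (branching_factors X F d)"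

definition DS_shattered :: "('a \<Rightarrow> 'a) set \<Rightarrow> 'a set \<Rightarrow> bool" where
  "DS_shattered F A \<longleftrightarrow>
     (\<exists>H. H \<noteq> {} \<and> finite H \<and> H \<subseteq> F \<and>
        (\<forall>x\<in>A. \<forall>h\<in>H. \<exists>g\<in>H. g x \<noteq> h x \<and> (\<forall>z\<in>A - {x}. g z = h z)))"

text \<open>Only finite \<open>A\<close> matter: a finite \<open>H\<close> cannot shatter an infinite set. The guard is needed because
  \<open>card\<close> is \<open>0\<close> on infinite sets.\<close>

definition DS_dim :: "'a set \<Rightarrow> ('a \<Rightarrow> 'a) set \<Rightarrow> enat" where
  "DS_dim X F = Sup {enat (card A) | A. A \<subseteq> X \<and> finite A \<and> DS_shattered F A}"

text \<open>Here \<open>\<T>\<close> labels the internal nodes (lists of length \<open>< d\<close>) and \<open>Y\<close> the edges, an edge being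
  identified with its lower endpoint (a non-empty list of length \<open>\<le> d\<close>).\<close>

definition littlestone_shattered :: "'a set \<Rightarrow> ('a \<Rightarrow> 'a) set \<Rightarrow> nat \<Rightarrow> (bool list \<Rightarrow> 'a) \<Rightarrow> bool" where
  "littlestone_shattered X F d \<T> \<longleftrightarrow>
     (\<exists>Y. (\<forall>s. 1 \<le> length s \<and> length s \<le> d \<longrightarrow> Y s \<in> X) \<and>
        (\<forall>\<sigma>. length \<sigma> = d \<longrightarrow>
           (\<exists>f\<in>F. \<forall>t\<in>{1..d}.
              f (\<T> (take (t - 1) \<sigma>)) = Y (take t \<sigma>) \<and>
              Y (take (t - 1) \<sigma> @ [False]) \<noteq> Y (take (t - 1) \<sigma> @ [True]))))"

definition littlestone_dim :: "'a set \<Rightarrow> ('a \<Rightarrow> 'a) set \<Rightarrow> enat" where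
  "littlestone_dim X F =
     Sup {enat d | d. \<exists>\<T>. (\<forall>s. length s < d \<longrightarrow> \<T> s \<in> X) \<and> littlestone_shattered X F d \<T>}"

end

theory Submission
  imports Defs "HOL-Library.Countable"
begin

text \<open>
  (i) Let the points be pairs of a level and a bit, and let \<open>F\<close> consist of all maps that raise the
  level by one and return bit 0 unless the new level is a power of two. Trajectories branch exactly
  at powers of two, while the values at different points are chosen independently.
  (ii) Let the \<open>\<sigma>\<close>-th function walk down the branch \<open>\<sigma>\<close> of a binary tree and reveal \<open>\<sigma>\<close> at every
  point off this branch. A point where a function reveals itself is useless for DS-shattering, and
  of two points on a common branch the lower one determines the value at the upper one.
  (iii) Skipping the levels at which a shattered trajectory tree does not branch leaves a
  Littlestone tree.
  (iv) If all values lie in \<open>{0,1}\<close> and both 0 and 1 are sent to 0, then only the first step can branch.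
\<close>

section \<open>Branching factors and evolution complexity\<close>

lemma ball_atLeast1_atMost_iff: "(\<forall>t\<in>{1..d}. P t) \<longleftrightarrow> (\<forall>i<d. P (Suc i))"
  unfolding image_Suc_lessThan[symmetric] by auto

text \<open>The shift \<open>t = Suc i\<close> removes the truncated subtraction
  \<open>t - 1\<close>; later arguments count steps from 0.\<close>

lemma trajectory_shattered_iff:
  "trajectory_shattered F d \<T> \<longleftrightarrow>
     (\<forall>\<sigma>. length \<sigma> = d \<longrightarrow> (\<exists>f\<in>F. \<forall>i<d. f (\<T> (take i \<sigma>)) = \<T> (take (Suc i) \<sigma>)))"
  by (simp add: trajectory_shattered_def ball_atLeast1_atMost_iff del: One_nat_def)

lemma littlestone_shattered_iff:
  "littlestone_shattered X F d \<T> \<longleftrightarrow>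
     (\<exists>Y. (\<forall>s. 1 \<le> length s \<and> length s \<le> d \<longrightarrow> Y s \<in> X) \<and>
        (\<forall>\<sigma>. length \<sigma> = d \<longrightarrow>
           (\<exists>f\<in>F. \<forall>i<d. f (\<T> (take i \<sigma>)) = Y (take (Suc i) \<sigma>) \<and>
              Y (take i \<sigma> @ [False]) \<noteq> Y (take i \<sigma> @ [True]))))"
  by (simp add: littlestone_shattered_def ball_atLeast1_atMost_iff del: One_nat_def)

text \<open>Padding \<open>s @ [b]\<close> to a full sign vector yields a function for this one
  edge. It may vary with the edge, so only properties shared by the whole class can be drawn from
  it.\<close>

lemma trajectory_shattered_step:
  assumes "trajectory_shattered F d \<T>" "length s < d"
  obtains f where "f \<in> F" "f (\<T> s) = \<T> (s @ [b])"
proof -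
  define \<sigma> where "\<sigma> = s @ [b] @ replicate (d - Suc (length s)) False"
  have "length \<sigma> = d"
    using assms(2) by (simp add: \<sigma>_def)
  then obtain f where "f \<in> F" "\<forall>i<d. f (\<T> (take i \<sigma>)) = \<T> (take (Suc i) \<sigma>)"
    using assms(1) unfolding trajectory_shattered_iff by blast
  then have "f \<in> F" "f (\<T> (take (length s) \<sigma>)) = \<T> (take (Suc (length s)) \<sigma>)"
    using assms(2) by auto
  then show thesis
    by (intro that[of f]) (simp_all add: \<sigma>_def)
qed

definition branch_count :: "nat \<Rightarrow> (bool list \<Rightarrow> 'a) \<Rightarrow> bool list \<Rightarrow> nat" where
  "branch_count d \<T> \<sigma> = card {i. i < d \<and> \<T> (take i \<sigma> @ [False]) \<noteq> \<T> (take i \<sigma> @ [True])}"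

lemma branching_factor_eq: "branching_factor d \<T> = Min (branch_count d \<T> ` {\<sigma>. length \<sigma> = d})"
proof -
  have "(\<Sum>t=1..d. of_bool (\<T> (take (t - 1) \<sigma> @ [False]) \<noteq> \<T> (take (t - 1) \<sigma> @ [True]))) =
      branch_count d \<T> \<sigma>" for \<sigma>
  proof -
    have "{..<d} \<inter> {i. \<T> (take i \<sigma> @ [False]) \<noteq> \<T> (take i \<sigma> @ [True])} =
        {i. i < d \<and> \<T> (take i \<sigma> @ [False]) \<noteq> \<T> (take i \<sigma> @ [True])}"
      by auto
    then show ?thesis
      unfolding branch_count_def One_nat_def sum.atLeast1_atMost_eq[unfolded One_nat_def] by simp
  qed
  then show ?thesis
    by (simp add: branching_factor_def)
qed

lemma finite_bool_lists: "finite {\<sigma> :: bool list. length \<sigma> = d}"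
  using finite_lists_length_eq[of "UNIV :: bool set" d] by simp

lemma le_branching_factor_iff:
  "b \<le> branching_factor d \<T> \<longleftrightarrow> (\<forall>\<sigma>. length \<sigma> = d \<longrightarrow> b \<le> branch_count d \<T> \<sigma>)"
proof -
  have "branch_count d \<T> ` {\<sigma>. length \<sigma> = d} \<noteq> {}"
    by (auto intro: exI[of _ "replicate d False"])
  then show ?thesis
    unfolding branching_factor_eq using finite_bool_lists[of d] by (subst Min_ge_iff) auto
qed

lemma branching_factor_le_branch_count:
  "length \<sigma> = d \<Longrightarrow> branching_factor d \<T> \<le> branch_count d \<T> \<sigma>"
  using le_branching_factor_iff by blast

lemma le_evolution_complexityI:
  assumes "trajectory_tree X d \<T>" "trajectory_shattered F d \<T>"
    and "\<And>\<sigma>. length \<sigma> = d \<Longrightarrow> b \<le> branch_count d \<T> \<sigma>"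
  shows "b \<le> evolution_complexity X F d"
proof -
  have "b \<le> branching_factor d \<T>"
    using assms(3) by (simp add: le_branching_factor_iff)
  also have "\<dots> \<le> evolution_complexity X F d"
    unfolding evolution_complexity_def using assms(1,2)
    by (intro cSup_upper bdd_above_branching_factors) (auto simp: branching_factors_def)
  finally show ?thesis .
qed

text \<open>A non-empty set of naturals bounded by \<open>d\<close> is finite, so its supremum is
  attained. The first case covers \<open>Sup {} = 0\<close>, when no tree of this depth is
  shattered.\<close>

lemma evolution_complexity_cases:
  obtains "evolution_complexity X F d = 0"
  | \<T> where "trajectory_tree X d \<T>" "trajectory_shattered F d \<T>"
      "evolution_complexity X F d = branching_factor d \<T>"
proof (cases "branching_factors X F d = {}")
  case True
  then show thesis
    by (intro that(1)) (simp add: evolution_complexity_def Sup_nat_def)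
next
  case False
  moreover have "finite (branching_factors X F d)"
    by (rule finite_subset[of _ "{..d}"]) (auto simp: branching_factors_def branching_factor_le)
  ultimately have "evolution_complexity X F d \<in> branching_factors X F d"
    by (simp add: evolution_complexity_def Sup_nat_def)
  then show thesis
    unfolding branching_factors_def using that(2) by blast
qed

lemma evolution_complexity_le: "evolution_complexity X F d \<le> d"
  by (rule evolution_complexity_cases[of X F d]) (auto simp: branching_factor_le)

section \<open>Infinite DS dimension with logarithmic evolution complexity\<close>

text \<open>The number \<open>m\<close> stands for the level \<open>m div 2\<close> with the bit \<open>m mod 2\<close>.\<close>

definition dyadic_maps :: "(nat \<Rightarrow> nat) set" where
  "dyadic_maps = {f. \<forall>m. f m div 2 = Suc (m div 2) \<and> (odd (f m) \<longrightarrow> (\<exists>k. Suc (m div 2) = 2 ^ k))}"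

text \<open>Where the next level is a power of two the bit is free, so the subsets of
  \<open>A\<close> index a Boolean cube inside the class.\<close>

lemma dyadic_maps_DS_shattered:
  assumes "finite A" and A: "\<And>m. m \<in> A \<Longrightarrow> \<exists>k. Suc (m div 2) = 2 ^ k"
  shows "DS_shattered dyadic_maps A"
proof -
  define h :: "nat set \<Rightarrow> nat \<Rightarrow> nat" where
    "h B m = 2 * Suc (m div 2) + of_bool (m \<in> B)" for B m
  have "h ` Pow A \<subseteq> dyadic_maps"
    using A by (auto simp: h_def dyadic_maps_def)
  moreover have "\<exists>g\<in>h ` Pow A. g x \<noteq> h B x \<and> (\<forall>z\<in>A - {x}. g z = h B z)"
    if "x \<in> A" "B \<subseteq> A" for x B
  proof
    \<comment> \<open>Toggling \<open>x\<close> in \<open>B\<close> changes the value at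
      \<open>x\<close> and nowhere else.\<close>
    show "h (if x \<in> B then B - {x} else insert x B) \<in> h ` Pow A"
      using that by auto
  qed (auto simp: h_def)
  ultimately show ?thesis
    unfolding DS_shattered_def using \<open>finite A\<close> by (intro exI[of _ "h ` Pow A"]) auto
qed

lemma DS_dim_eq_infinityI:
  assumes "\<And>d. \<exists>A\<subseteq>X. finite A \<and> card A = d \<and> DS_shattered F A"
  shows "DS_dim X F = \<infinity>"
proof -
  have "enat d \<le> DS_dim X F" for d
    unfolding DS_dim_def using assms[of d] by (intro Sup_upper) blast
  then show ?thesis
    by (metis enat_ord_simps(1) not_infinity_eq not_less_eq_eq order_refl)
qed

lemma DS_dim_dyadic_maps: "DS_dim UNIV dyadic_maps = \<infinity>"
proof (rule DS_dim_eq_infinityI)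
  fix d
  \<comment> \<open>\<open>2 * (2 ^ k - 1)\<close> is the point of level \<open>2 ^ k - 1\<close>
    with bit 0, so its next level is \<open>2 ^ k\<close>.\<close>
  have inj: "inj (\<lambda>k::nat. 2 * (2 ^ k - 1 :: nat))"
  proof (rule injI)
    fix j k :: nat
    assume "2 * (2 ^ j - 1 :: nat) = 2 * (2 ^ k - 1)"
    moreover have "(1::nat) \<le> 2 ^ j" "(1::nat) \<le> 2 ^ k"
      by simp_all
    ultimately have "(2::nat) ^ j = 2 ^ k"
      by linarith
    then show "j = k"
      by simp
  qed
  show "\<exists>A\<subseteq>UNIV. finite A \<and> card A = d \<and> DS_shattered dyadic_maps A"
    by (intro exI[of _ "(\<lambda>k. 2 * (2 ^ k - 1)) ` {..<d}"] conjI dyadic_maps_DS_shattered)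
      (use card_image[OF inj_on_subset[OF inj]] in auto)
qed

text \<open>If \<open>2 ^ j\<close> and \<open>2 ^ (j + m)\<close> both lie among \<open>T\<close>
  consecutive positive integers, their distance \<open>2 ^ j * (2 ^ m - 1)\<close> is below
  \<open>T\<close>, hence \<open>2 ^ m \<le> T\<close>. The offset \<open>N\<close> is arbitrary
  because a trajectory may start at any level.\<close>

lemma card_powers_of_two_le:
  assumes "T \<ge> 1"
  shows "2 ^ (card {i. i < T \<and> (\<exists>k. Suc (N + i) = 2 ^ k)} - 1) \<le> T"
proof -
  define S where "S = {i. i < T \<and> (\<exists>k. Suc (N + i) = 2 ^ k)}"
  define K where "K = {k::nat. N < 2 ^ k \<and> 2 ^ k \<le> N + T}"
  have "K \<subseteq> {..N + T}"
    unfolding K_def using less_exp order_trans order_less_imp_le by blast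
  then have fin: "finite K"
    using finite_subset by blast
  have "S \<subseteq> (\<lambda>k. 2 ^ k - Suc N) ` K"
  proof
    fix i
    assume "i \<in> S"
    then obtain k where "i < T" "Suc (N + i) = 2 ^ k"
      by (auto simp: S_def)
    then have "k \<in> K" "i = 2 ^ k - Suc N"
      by (auto simp: K_def)
    then show "i \<in> (\<lambda>k. 2 ^ k - Suc N) ` K"
      by blast
  qed
  then have card_S: "card S \<le> card K"
    using fin surj_card_le by blast
  have "2 ^ (card K - 1) \<le> T"
  proof (cases "K = {}")
    case True
    \<comment> \<open>Truncated subtraction gives \<open>2 ^ (0 - 1) = 1\<close>, so
      \<open>T \<ge> 1\<close> is what this case requires.\<close>
    then show ?thesis
      using assms by simp
  next
    case False
    define j where "j = Min K"
    define m where "m = Max K - j"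
    have "K \<subseteq> {j..j + m}"
    proof
      fix k
      assume "k \<in> K"
      then have "Min K \<le> k" "k \<le> Max K"
        using fin by auto
      then show "k \<in> {j..j + m}"
        by (simp add: j_def m_def)
    qed
    then have "card K \<le> Suc m"
      using card_mono[of "{j..j + m}" K] by simp
    moreover have "2 ^ m \<le> T"
    proof -
      have mem: "j \<in> K" "j + m \<in> K"
        using fin False Min_in Max_in Min_le by (auto simp: j_def m_def)
      then have "2 ^ j * 2 ^ m < 2 ^ j + T"
        by (auto simp: K_def power_add)
      moreover have "2 ^ j + 2 ^ m \<le> Suc (2 ^ j * 2 ^ m)"
      proof -
        have "(0::int) \<le> (2 ^ j - 1) * (2 ^ m - 1)"
          by simp
        then have "int (2 ^ j + 2 ^ m) \<le> int (Suc (2 ^ j * 2 ^ m))"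
          by (simp add: algebra_simps)
        then show ?thesis
          by linarith
      qed
      ultimately show ?thesis
        by linarith
    qed
    ultimately show ?thesis
      by (metis diff_Suc_1 diff_le_mono order_trans one_le_numeral power_increasing)
  qed
  moreover have "(2::nat) ^ (card S - 1) \<le> 2 ^ (card K - 1)"
    using card_S by (intro power_increasing) auto
  ultimately show ?thesis
    unfolding S_def by (rule order_trans[rotated])
qed

text \<open>The level at a node is determined by its depth, so distinct siblings differ in their bit
  and one of them is odd. Branching therefore happens only where the new level is a power of
  two.\<close>

lemma evolution_complexity_dyadic_maps_upper:
  assumes "T \<ge> 1"
  shows "2 ^ (evolution_complexity UNIV dyadic_maps T - 1) \<le> T"
proof (rule evolution_complexity_cases[of UNIV dyadic_maps T])
  fix \<T>
  assume sh: "trajectory_shattered dyadic_maps T \<T>"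
    and C: "evolution_complexity UNIV dyadic_maps T = branching_factor T \<T>"
  define N where "N = \<T> [] div 2"
  have level: "length s \<le> T \<Longrightarrow> \<T> s div 2 = N + length s" for s
  proof (induction s rule: rev_induct)
    case (snoc b s)
    then obtain f where "f \<in> dyadic_maps" "f (\<T> s) = \<T> (s @ [b])"
      using trajectory_shattered_step[OF sh, of s b] by auto
    then have "\<T> (s @ [b]) div 2 = Suc (\<T> s div 2)"
      by (metis (mono_tags, lifting) dyadic_maps_def mem_Collect_eq)
    with snoc show ?case
      by simp
  qed (simp add: N_def)
  have power: "\<exists>k. Suc (N + length s) = 2 ^ k" if "odd (\<T> (s @ [b]))" and less: "length s < T" for s b
  proof -
    obtain f where "f \<in> dyadic_maps" "f (\<T> s) = \<T> (s @ [b])"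
      using trajectory_shattered_step[OF sh less] .
    with that level[of s] show ?thesis
      by (auto simp: dyadic_maps_def) metis
  qed
  \<comment> \<open>The branching factor is a minimum over paths, so bounding the count on any
    single path suffices.\<close>
  define \<sigma> where "\<sigma> = replicate T False"
  have "\<exists>k. Suc (N + i) = 2 ^ k"
    if "i < T" and ne: "\<T> (take i \<sigma> @ [False]) \<noteq> \<T> (take i \<sigma> @ [True])" for i
  proof -
    have len: "length (take i \<sigma>) = i"
      using that(1) by (simp add: \<sigma>_def)
    then have "\<T> (take i \<sigma> @ [False]) div 2 = \<T> (take i \<sigma> @ [True]) div 2"
      using that(1) by (simp add: level)
    with ne have "odd (\<T> (take i \<sigma> @ [False])) \<or> odd (\<T> (take i \<sigma> @ [True]))"
      by (metis even_two_times_div_two)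
    then show ?thesis
      using power len that(1) by metis
  qed
  then have "branch_count T \<T> \<sigma> \<le> card {i. i < T \<and> (\<exists>k. Suc (N + i) = 2 ^ k)}"
    unfolding branch_count_def by (intro card_mono) auto
  then have "branching_factor T \<T> \<le> card {i. i < T \<and> (\<exists>k. Suc (N + i) = 2 ^ k)}"
    using branching_factor_le_branch_count[of \<sigma> T \<T>] by (simp add: \<sigma>_def)
  then have "(2::nat) ^ (branching_factor T \<T> - 1) \<le>
      2 ^ (card {i. i < T \<and> (\<exists>k. Suc (N + i) = 2 ^ k)} - 1)"
    by (intro power_increasing) auto
  also have "\<dots> \<le> T"
    using card_powers_of_two_le[OF assms] .
  finally show ?thesis
    using C by simp
qed (use assms in simp)

text \<open>A tree starting at level 0 that stores the last sign in the bit at power-of-two depths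
  branches into the depths \<open>2 ^ 0\<close>, ..., \<open>2 ^ c\<close>.\<close>

lemma evolution_complexity_dyadic_maps_lower:
  assumes "2 ^ c \<le> T"
  shows "Suc c \<le> evolution_complexity UNIV dyadic_maps T"
proof (rule le_evolution_complexityI)
  define \<T> :: "bool list \<Rightarrow> nat" where
    "\<T> s = 2 * length s + of_bool (s \<noteq> [] \<and> last s \<and> (\<exists>k. length s = 2 ^ k))" for s
  show "trajectory_tree UNIV T \<T>"
    by (simp add: trajectory_tree_def)
  show "trajectory_shattered dyadic_maps T \<T>"
    unfolding trajectory_shattered_iff
  proof (intro allI impI)
    fix \<sigma> :: "bool list"
    assume len: "length \<sigma> = T"
    \<comment> \<open>The level of \<open>m\<close> serves as a clock that tells which sign of
      \<open>\<sigma>\<close> comes next; from level \<open>T\<close> on the bit is 0.\<close>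
    define f where "f m = (if m div 2 < T then \<T> (take (Suc (m div 2)) \<sigma>) else 2 * Suc (m div 2))" for m
    have "f \<in> dyadic_maps"
      using len by (auto simp: dyadic_maps_def f_def \<T>_def split: if_splits)
    moreover have "\<forall>i<T. f (\<T> (take i \<sigma>)) = \<T> (take (Suc i) \<sigma>)"
      using len by (auto simp: f_def) (simp_all add: \<T>_def)
    ultimately show "\<exists>f\<in>dyadic_maps. \<forall>i<T. f (\<T> (take i \<sigma>)) = \<T> (take (Suc i) \<sigma>)"
      by blast
  qed
  fix \<sigma> :: "bool list"
  assume len: "length \<sigma> = T"
  have "(\<lambda>k. 2 ^ k - 1) ` {..c} \<subseteq> {i. i < T \<and> \<T> (take i \<sigma> @ [False]) \<noteq> \<T> (take i \<sigma> @ [True])}"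
  proof clarsimp
    fix k
    assume "k \<le> c"
    then have "(2::nat) ^ k \<le> 2 ^ c"
      by simp
    then have less: "2 ^ k - Suc 0 < T"
      using assms zero_less_power[of "2::nat" k] by linarith
    then show "2 ^ k - Suc 0 < T \<and>
        \<T> (take (2 ^ k - Suc 0) \<sigma> @ [False]) \<noteq> \<T> (take (2 ^ k - Suc 0) \<sigma> @ [True])"
      using len by (auto simp: \<T>_def)
  qed
  moreover have "inj_on (\<lambda>k. 2 ^ k - 1 :: nat) {..c}"
    by (rule inj_onI) (metis Suc_diff_1 one_less_numeral_iff pos2 power_inject_exp semiring_norm(76) zero_less_power)
  ultimately show "Suc c \<le> branch_count T \<T> \<sigma>"
    unfolding branch_count_def
    using card_mono[of "{i. i < T \<and> \<T> (take i \<sigma> @ [False]) \<noteq> \<T> (take i \<sigma> @ [True])}"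
      "(\<lambda>k. 2 ^ k - 1) ` {..c}"] by (simp add: card_image)
qed

lemma evolution_complexity_dyadic_maps:
  "(\<lambda>T. real (evolution_complexity UNIV dyadic_maps T)) \<in> \<Theta>(\<lambda>T. ln (real T))"
proof (rule bigthetaI')
  \<comment> \<open>The two bounds give \<open>2 ^ (C - 1) \<le> T < 2 ^ C\<close>, so
    \<open>C\<close> exceeds the binary logarithm of \<open>T\<close> by at most 1. For
    \<open>T \<ge> 2\<close> this 1 is absorbed by the factor 2.\<close>
  show "eventually (\<lambda>T. 1 / ln 2 * norm (ln (real T)) \<le> norm (real (evolution_complexity UNIV dyadic_maps T)) \<and>
      norm (real (evolution_complexity UNIV dyadic_maps T)) \<le> 2 / ln 2 * norm (ln (real T))) at_top"
    using eventually_ge_at_top[of 2]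
  proof eventually_elim
    case (elim T)
    define C where "C = evolution_complexity UNIV dyadic_maps T"
    obtain c where c: "2 ^ c \<le> T" "T < 2 ^ (c + 1)"
      using ex_power_ivl1[of 2 T] elim by auto
    have "T < 2 ^ C"
    proof -
      have "(2::nat) ^ (c + 1) \<le> 2 ^ C"
        using evolution_complexity_dyadic_maps_lower[OF c(1)] by (simp add: C_def del: power_Suc)
      with c(2) show ?thesis
        by linarith
    qed
    then have "real T \<le> real (2 ^ C)"
      by (intro of_nat_mono) simp
    then have "ln (real T) \<le> ln (2 ^ C)"
      using elim by simp
    then have lower: "ln (real T) \<le> real C * ln 2"
      by (simp add: ln_realpow)
    have "2 ^ (C - 1) \<le> T"
      using evolution_complexity_dyadic_maps_upper[of T] elim by (simp add: C_def)
    then have "real (2 ^ (C - 1)) \<le> real T"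
      by (rule of_nat_mono)
    then have "ln (2 ^ (C - 1)) \<le> ln (real T)"
      using elim by simp
    then have "real (C - 1) * ln 2 \<le> ln (real T)"
      by (simp add: ln_realpow)
    moreover have "real C * ln 2 \<le> (real (C - 1) + 1) * ln 2"
      by (intro mult_right_mono) auto
    moreover have "ln 2 \<le> ln (real T)"
      using elim by simp
    ultimately have upper: "real C * ln 2 \<le> 2 * ln (real T)"
      by (simp add: algebra_simps)
    from lower upper elim show ?case
      by (simp add: C_def field_simps)
  qed
qed simp_all

section \<open>DS dimension one with maximal evolution complexity\<close>

text \<open>Even numbers encode the nodes of the tree, odd numbers the names of branches.\<close>

definition tree_node :: "nat \<Rightarrow> bool list" where
  "tree_node n = from_nat (n div 2)"

text \<open>Finite branches of every length are collected in one class, so a countable set of points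
  serves all depths. At the end node of \<open>\<sigma>\<close> the value is already the name of the
  branch.\<close>

definition branch_map :: "bool list \<Rightarrow> nat \<Rightarrow> nat" where
  "branch_map \<sigma> n =
     (if even n \<and> length (tree_node n) < length \<sigma> \<and> take (length (tree_node n)) \<sigma> = tree_node n
      then 2 * to_nat (take (Suc (length (tree_node n))) \<sigma>) else Suc (2 * to_nat \<sigma>))"

lemma tree_node_encode [simp]: "tree_node (2 * to_nat s) = s"
  by (simp add: tree_node_def)

lemma branch_map_encode:
  "i < length \<sigma> \<Longrightarrow> branch_map \<sigma> (2 * to_nat (take i \<sigma>)) = 2 * to_nat (take (Suc i) \<sigma>)"
  by (simp add: branch_map_def)

text \<open>Odd values are names of whole branches, even values are codes of nodes; a name
  determines its function.\<close>

lemma branch_map_odd_inject: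
  assumes "odd (branch_map \<sigma> n)" "branch_map \<tau> n = branch_map \<sigma> n"
  shows "\<tau> = \<sigma>"
  using assms by (auto simp: branch_map_def split: if_splits) presburger+

lemma branch_map_even:
  assumes "even (branch_map \<sigma> n)"
  shows "length (tree_node n) < length \<sigma>"
    and "take (length (tree_node n)) \<sigma> = tree_node n"
    and "branch_map \<sigma> n = 2 * to_nat (take (Suc (length (tree_node n))) \<sigma>)"
  using assms by (auto simp: branch_map_def split: if_splits)

text \<open>In a shattering \<open>H\<close> no function may reveal itself at either point, so every
  branch in \<open>H\<close> passes through both nodes. Its value at the node \<open>z\<close>, at
  least as deep as \<open>x\<close>, then fixes its value at \<open>x\<close>.\<close>

lemma branch_maps_no_pair:
  assumes "DS_shattered (range branch_map) A" and xz: "x \<in> A" "z \<in> A" "x \<noteq> z"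
    and le: "length (tree_node x) \<le> length (tree_node z)"
  shows False
proof -
  from assms(1) obtain H where H: "H \<noteq> {}" "H \<subseteq> range branch_map"
    and DS: "\<forall>x\<in>A. \<forall>h\<in>H. \<exists>g\<in>H. g x \<noteq> h x \<and> (\<forall>z\<in>A - {x}. g z = h z)"
    unfolding DS_shattered_def by (elim exE conjE)
  \<comment> \<open>A neighbour of \<open>branch_map \<sigma>\<close> in direction \<open>v\<close>
    agrees with it at \<open>u\<close>; an odd common value would make the two equal.\<close>
  have even: "even (branch_map \<sigma> u)"
    if \<sigma>: "branch_map \<sigma> \<in> H" and uv: "u \<in> A" "v \<in> A" "u \<noteq> v" for \<sigma> u v
  proof (rule ccontr)
    assume odd: "odd (branch_map \<sigma> u)"
    obtain g where "g \<in> H" and ne: "g v \<noteq> branch_map \<sigma> v" and eq: "g u = branch_map \<sigma> u"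
      using bspec[OF bspec[OF DS uv(2)] \<sigma>] uv by blast
    then obtain \<tau> where g: "g = branch_map \<tau>"
      using H(2) by blast
    then have "\<tau> = \<sigma>"
      using branch_map_odd_inject[OF odd] eq by simp
    with ne g show False
      by simp
  qed
  obtain \<sigma> where \<sigma>: "branch_map \<sigma> \<in> H"
    using H by blast
  obtain g where "g \<in> H" "g x \<noteq> branch_map \<sigma> x" "g z = branch_map \<sigma> z"
    using bspec[OF bspec[OF DS xz(1)] \<sigma>] xz by blast
  then obtain \<tau> where \<tau>: "branch_map \<tau> \<in> H" "branch_map \<tau> x \<noteq> branch_map \<sigma> x"
    "branch_map \<tau> z = branch_map \<sigma> z"
    using H(2) by blast
  \<comment> \<open>Equal even values at \<open>z\<close> mean equal prefixes one step below
    \<open>z\<close>, and hence one step below \<open>x\<close>.\<close>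
  have "take (Suc (length (tree_node z))) \<tau> = take (Suc (length (tree_node z))) \<sigma>"
    using \<tau>(3) branch_map_even(3)[OF even[OF \<sigma>, of z x]] branch_map_even(3)[OF even[OF \<tau>(1), of z x]] xz
    by simp
  then have "take (Suc (length (tree_node x))) \<tau> = take (Suc (length (tree_node x))) \<sigma>"
    using le by (metis Suc_le_mono min.absorb1 take_take)
  then have "branch_map \<tau> x = branch_map \<sigma> x"
    using branch_map_even(3)[OF even[OF \<sigma>, of x z]] branch_map_even(3)[OF even[OF \<tau>(1), of x z]] xz
    by simp
  with \<tau>(2) show False
    by simp
qed

lemma DS_dim_branch_maps: "DS_dim UNIV (range branch_map) = 1"
proof (rule antisym)
  show "DS_dim UNIV (range branch_map) \<le> 1"
    unfolding DS_dim_def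
  proof (rule Sup_least, clarify)
    fix A
    assume A: "finite A" "DS_shattered (range branch_map) A"
    have "x = z" if "x \<in> A" "z \<in> A" for x z
      using branch_maps_no_pair[OF A(2)] that by (metis linorder_le_cases)
    then have "card A \<le> 1"
      using A(1) by (simp add: card_le_Suc0_iff_eq)
    then show "enat (card A) \<le> 1"
      by (simp add: one_enat_def)
  qed
  \<comment> \<open>At the root, the two branches of length 1 already differ, which shatters a
    singleton.\<close>
  define r where "r = 2 * to_nat ([] :: bool list)"
  have r: "branch_map [b] r = 2 * to_nat [b]" for b
    using branch_map_encode[of 0 "[b]"] by (simp add: r_def)
  have "DS_shattered (range branch_map) {r}"
    unfolding DS_shattered_def
  proof (intro exI[of _ "{branch_map [False], branch_map [True]}"] conjI ballI)
    fix x h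
    assume "x \<in> {r}" "h \<in> {branch_map [False], branch_map [True]}"
    then show "\<exists>g\<in>{branch_map [False], branch_map [True]}. g x \<noteq> h x \<and> (\<forall>z\<in>{r} - {x}. g z = h z)"
      by (elim insertE emptyE) (simp_all add: r)
  qed auto
  then show "1 \<le> DS_dim UNIV (range branch_map)"
    unfolding DS_dim_def one_enat_def by (intro Sup_upper) (auto intro!: exI[of _ "{r}"])
qed

text \<open>Labelling every sign list by its own code makes all siblings distinct, and
  \<open>branch_map \<sigma>\<close> walks down the path \<open>\<sigma>\<close>.\<close>

lemma evolution_complexity_branch_maps: "evolution_complexity UNIV (range branch_map) T = T"
proof (rule antisym[OF evolution_complexity_le le_evolution_complexityI])
  define \<T> :: "bool list \<Rightarrow> nat" where "\<T> s = 2 * to_nat s" for s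
  show "trajectory_tree UNIV T \<T>"
    by (simp add: trajectory_tree_def)
  show "trajectory_shattered (range branch_map) T \<T>"
    unfolding trajectory_shattered_iff
  proof (intro allI impI)
    show "\<exists>f\<in>range branch_map. \<forall>i<T. f (\<T> (take i \<sigma>)) = \<T> (take (Suc i) \<sigma>)" if "length \<sigma> = T" for \<sigma>
      using that by (intro bexI[of _ "branch_map \<sigma>"]) (auto simp: \<T>_def branch_map_encode)
  qed
  show "T \<le> branch_count T \<T> \<sigma>" for \<sigma>
    by (simp add: branch_count_def \<T>_def)
qed

section \<open>Evolution complexity and Littlestone dimension\<close>

lemma littlestone_shattered_mono:
  assumes "littlestone_shattered X F d \<T>" "F \<subseteq> G"
  shows "littlestone_shattered X G d \<T>"
  using assms(1) unfolding littlestone_shattered_def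
  by (elim exE conjE, intro exI conjI) (assumption, use assms(2) in fast)

text \<open>Two trees are joined below a new root \<open>x\<close>. Restricting each subclass to one
  value at \<open>x\<close> makes the functions realising a subtree also realise the root edge above
  it.\<close>

lemma littlestone_shattered_Suc:
  assumes "littlestone_shattered X {f \<in> F. f x = y False} d (\<T> False)"
    and "littlestone_shattered X {f \<in> F. f x = y True} d (\<T> True)"
    and y: "y False \<noteq> y True" "\<And>b. y b \<in> X"
  shows "littlestone_shattered X F (Suc d) (case_list x \<T>)"
proof -
  have "\<forall>b. littlestone_shattered X {f \<in> F. f x = y b} d (\<T> b)"
    using assms(1,2) by (simp add: all_bool_eq)
  from choice[OF this[unfolded littlestone_shattered_iff]]
  obtain Y where Y: "\<And>b s. 1 \<le> length s \<Longrightarrow> length s \<le> d \<Longrightarrow> Y b s \<in> X"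
    and real: "\<And>b \<sigma>. length \<sigma> = d \<Longrightarrow>
           \<exists>f\<in>{f \<in> F. f x = y b}. \<forall>i<d. f (\<T> b (take i \<sigma>)) = Y b (take (Suc i) \<sigma>) \<and>
              Y b (take i \<sigma> @ [False]) \<noteq> Y b (take i \<sigma> @ [True])"
    by blast
  \<comment> \<open>Edges are non-empty lists, so the value at \<open>[]\<close> is a
    placeholder.\<close>
  define Z where "Z s = (case s of [] \<Rightarrow> x | b # s' \<Rightarrow> if s' = [] then y b else Y b s')" for s
  show ?thesis
    unfolding littlestone_shattered_iff
  proof (intro exI[of _ Z] conjI allI impI)
    fix s :: "bool list"
    assume s: "1 \<le> length s \<and> length s \<le> Suc d"
    then show "Z s \<in> X"
      using y(2) Y by (cases s) (auto simp: Z_def Suc_le_eq)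
  next
    fix \<sigma> :: "bool list"
    assume "length \<sigma> = Suc d"
    then obtain b \<sigma>' where \<sigma>: "\<sigma> = b # \<sigma>'" "length \<sigma>' = d"
      by (cases \<sigma>) auto
    then obtain f where f: "f \<in> F" "f x = y b" and
      fi: "\<And>i. i < d \<Longrightarrow> f (\<T> b (take i \<sigma>')) = Y b (take (Suc i) \<sigma>')"
         "\<And>i. i < d \<Longrightarrow> Y b (take i \<sigma>' @ [False]) \<noteq> Y b (take i \<sigma>' @ [True])"
      using real by blast
    have "f (case_list x \<T> (take i \<sigma>)) = Z (take (Suc i) \<sigma>) \<and>
        Z (take i \<sigma> @ [False]) \<noteq> Z (take i \<sigma> @ [True])" if "i < Suc d" for i
    proof (cases i)
      case 0
      then show ?thesis
        using f y(1) \<sigma> by (simp add: Z_def)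
    next
      case (Suc j)
      then have "j < d" "take (Suc j) \<sigma>' \<noteq> []"
        using that \<sigma>(2) by auto
      then show ?thesis
        using fi[of j] Suc \<sigma>(1) by (simp add: Z_def)
    qed
    with f(1) show "\<exists>f\<in>F. \<forall>i<Suc d. f (case_list x \<T> (take i \<sigma>)) = Z (take (Suc i) \<sigma>) \<and>
        Z (take i \<sigma> @ [False]) \<noteq> Z (take i \<sigma> @ [True])"
      by blast
  qed
qed

lemma branch_count_Cons:
  "branch_count (Suc d) Y (b # \<sigma>) =
     of_bool (Y [False] \<noteq> Y [True]) + branch_count d (\<lambda>s. Y (b # s)) \<sigma>"
proof -
  have "{i. i < Suc d \<and> Y (take i (b # \<sigma>) @ [False]) \<noteq> Y (take i (b # \<sigma>) @ [True])} =
      (if Y [False] \<noteq> Y [True] then {0} else {}) \<union>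
      Suc ` {i. i < d \<and> Y (b # take i \<sigma> @ [False]) \<noteq> Y (b # take i \<sigma> @ [True])}"
    by (auto simp: image_iff less_Suc_eq_0_disj split: if_splits)
  then show ?thesis
    unfolding branch_count_def by (simp add: card_image card_insert_if image_iff)
qed

text \<open>Induction on \<open>d\<close>: at a branching root both subtrees are kept, otherwise the
  left one replaces the whole tree. \<open>F\<close> varies in the induction because descending
  restricts it to the functions with the prescribed root value.\<close>

lemma littlestone_tree_of_branching:
  assumes "\<And>s. length s < d \<Longrightarrow> N s \<in> X" "\<And>s. 1 \<le> length s \<Longrightarrow> length s \<le> d \<Longrightarrow> Y s \<in> X"
    and "\<And>\<sigma>. length \<sigma> = d \<Longrightarrow> \<exists>f\<in>F. \<forall>i<d. f (N (take i \<sigma>)) = Y (take (Suc i) \<sigma>)"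
    and "\<And>\<sigma>. length \<sigma> = d \<Longrightarrow> b \<le> branch_count d Y \<sigma>"
  shows "\<exists>\<T>. (\<forall>s. length s < b \<longrightarrow> \<T> s \<in> X) \<and> littlestone_shattered X F b \<T>"
  using assms
proof (induction d arbitrary: N Y F b)
  case 0
  from "0.prems"(3)[of "[]"] "0.prems"(4)[of "[]"] have "F \<noteq> {}" "b = 0"
    by (auto simp: branch_count_def)
  then show ?case
    by (auto simp: littlestone_shattered_iff Suc_le_eq)
next
  case (Suc d)
  \<comment> \<open>The two inequalities say that \<open>m\<close> is \<open>b\<close> minus the
    contribution of the root, in truncated subtraction.\<close>
  have sub: "\<exists>\<T>. (\<forall>s. length s < m \<longrightarrow> \<T> s \<in> X) \<and>
      littlestone_shattered X {f \<in> F. f (N []) = Y [c]} m \<T>"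
    if "b \<le> of_bool (Y [False] \<noteq> Y [True]) + m" "m \<le> b - of_bool (Y [False] \<noteq> Y [True])" for c m
  proof (rule Suc.IH[of "\<lambda>s. N (c # s)" "\<lambda>s. Y (c # s)"])
    fix \<sigma> :: "bool list"
    assume len: "length \<sigma> = d"
    then obtain f where "f \<in> F" and
      f: "\<And>i. i < Suc d \<Longrightarrow> f (N (take i (c # \<sigma>))) = Y (take (Suc i) (c # \<sigma>))"
      using Suc.prems(3)[of "c # \<sigma>"] by auto
    then show "\<exists>f\<in>{f \<in> F. f (N []) = Y [c]}. \<forall>i<d. f (N (c # take i \<sigma>)) = Y (c # take (Suc i) \<sigma>)"
      using f[of 0] f[of "Suc _"] by (intro bexI[of _ f]) auto
    show "m \<le> branch_count d (\<lambda>s. Y (c # s)) \<sigma>"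
      using Suc.prems(4)[of "c # \<sigma>"] that len by (simp add: branch_count_Cons)
  qed (use Suc.prems(1,2) in auto)
  show ?case
  proof (cases "Y [False] \<noteq> Y [True] \<and> b \<noteq> 0")
    case True
    then obtain m where b: "b = Suc m"
      using not0_implies_Suc by blast
    have "\<forall>c. \<exists>\<T>. (\<forall>s. length s < m \<longrightarrow> \<T> s \<in> X) \<and>
        littlestone_shattered X {f \<in> F. f (N []) = Y [c]} m \<T>"
      using sub[of m] True b by simp
    from choice[OF this] obtain \<T> where \<T>: "\<And>c s. length s < m \<Longrightarrow> \<T> c s \<in> X"
      "\<And>c. littlestone_shattered X {f \<in> F. f (N []) = Y [c]} m (\<T> c)"
      by blast
    have "littlestone_shattered X F b (case_list (N []) \<T>)"
      unfolding b using \<T>(2) True Suc.prems(2)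
      by (intro littlestone_shattered_Suc[where y = "\<lambda>c. Y [c]"]) auto
    moreover have "\<forall>s. length s < b \<longrightarrow> case_list (N []) \<T> s \<in> X"
      using \<T>(1) Suc.prems(1)[of "[]"] b by (auto split: list.split)
    ultimately show ?thesis
      by blast
  next
    case False
    \<comment> \<open>Either the root does not branch or \<open>b = 0\<close>, so the left subtree
      alone provides depth \<open>b\<close>.\<close>
    then have "\<exists>\<T>. (\<forall>s. length s < b \<longrightarrow> \<T> s \<in> X) \<and>
        littlestone_shattered X {f \<in> F. f (N []) = Y [False]} b \<T>"
      by (intro sub) auto
    then show ?thesis
      using littlestone_shattered_mono[of X "{f \<in> F. f (N []) = Y [False]}" b _ F] by blast
  qed
qed

text \<open>An optimal trajectory tree supplies the node labels and the edge labels at once.\<close>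

lemma evolution_complexity_le_littlestone_dim:
  "enat (evolution_complexity X F d) \<le> littlestone_dim X F"
proof (rule evolution_complexity_cases[of X F d])
  fix \<T>
  assume tree: "trajectory_tree X d \<T>" and sh: "trajectory_shattered F d \<T>"
    and C: "evolution_complexity X F d = branching_factor d \<T>"
  have "\<exists>\<T>'. (\<forall>s. length s < branching_factor d \<T> \<longrightarrow> \<T>' s \<in> X) \<and>
      littlestone_shattered X F (branching_factor d \<T>) \<T>'"
    using tree sh
    by (intro littlestone_tree_of_branching[of d \<T> X \<T>])
      (auto simp: trajectory_tree_def trajectory_shattered_iff branching_factor_le_branch_count)
  then show ?thesis
    unfolding littlestone_dim_def C by (intro Sup_upper) blast
qed (simp add: zero_enat_def[symmetric])

section \<open>Infinite Littlestone dimension with evolution complexity one\<close>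

definition absorbed_maps :: "(nat \<Rightarrow> nat) set" where
  "absorbed_maps = {f. f 0 = 0 \<and> f 1 = 0 \<and> (\<forall>n. f n \<le> 1)}"

text \<open>Values at points from 2 on are free bits. All nodes of depth \<open>i\<close> share the
  label \<open>i + 2\<close>, and each edge is labelled by its sign.\<close>

lemma littlestone_dim_absorbed_maps: "littlestone_dim UNIV absorbed_maps = \<infinity>"
proof -
  have "littlestone_shattered UNIV absorbed_maps d (\<lambda>s. length s + 2)" for d
    unfolding littlestone_shattered_iff
  proof (intro exI[of _ "\<lambda>s. of_bool (last s)"] conjI allI impI)
    fix \<sigma> :: "bool list"
    assume len: "length \<sigma> = d"
    define f :: "nat \<Rightarrow> nat" where "f n = of_bool (2 \<le> n \<and> \<sigma> ! (n - 2))" for n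
    have "f \<in> absorbed_maps"
      by (simp add: absorbed_maps_def f_def)
    moreover have "\<forall>i<d. f (length (take i \<sigma>) + 2) = of_bool (last (take (Suc i) \<sigma>))"
      using len by (auto simp: f_def take_Suc_conv_app_nth)
    ultimately show "\<exists>f\<in>absorbed_maps. \<forall>i<d. f (length (take i \<sigma>) + 2) = of_bool (last (take (Suc i) \<sigma>)) \<and>
        (of_bool (last (take i \<sigma> @ [False])) :: nat) \<noteq> of_bool (last (take i \<sigma> @ [True]))"
      by (intro bexI[of _ f]) auto
  qed simp
  then have "enat d \<le> littlestone_dim UNIV absorbed_maps" for d
    unfolding littlestone_dim_def by (intro Sup_upper CollectI exI[of _ d] conjI exI) simp_all
  then show ?thesis
    by (metis enat_ord_simps(1) not_infinity_eq not_less_eq_eq order_refl)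
qed

text \<open>After one step a trajectory is in \<open>{0, 1}\<close>, after two it is at 0, so only
  the children of the root can differ.\<close>

lemma evolution_complexity_absorbed_maps:
  assumes "T \<ge> 1"
  shows "evolution_complexity UNIV absorbed_maps T = 1"
proof (rule antisym)
  show "evolution_complexity UNIV absorbed_maps T \<le> 1"
  proof (rule evolution_complexity_cases[of UNIV absorbed_maps T])
    fix \<T>
    assume sh: "trajectory_shattered absorbed_maps T \<T>"
      and C: "evolution_complexity UNIV absorbed_maps T = branching_factor T \<T>"
    have le: "\<T> (s @ [b]) \<le> 1" if "length s < T" for s b
      using trajectory_shattered_step[OF sh that, of b] by (metis (mono_tags, lifting) absorbed_maps_def mem_Collect_eq)
    have zero: "\<T> (s @ [b]) = 0" if less: "length s < T" and "s \<noteq> []" for s b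
    proof -
      have "\<T> s \<le> 1"
        using le[of "butlast s" "last s"] that by simp
      moreover obtain f where "f \<in> absorbed_maps" "f (\<T> s) = \<T> (s @ [b])"
        using trajectory_shattered_step[OF sh less] .
      ultimately show ?thesis
        by (auto simp: absorbed_maps_def le_Suc_eq)
    qed
    define \<sigma> where "\<sigma> = replicate T False"
    have "i = 0" if "i < T" "\<T> (take i \<sigma> @ [False]) \<noteq> \<T> (take i \<sigma> @ [True])" for i
      using zero[of "take i \<sigma>"] that by (cases i) (auto simp: \<sigma>_def)
    then have "branch_count T \<T> \<sigma> \<le> card {0::nat}"
      unfolding branch_count_def by (intro card_mono) auto
    then show ?thesis
      using branching_factor_le_branch_count[of \<sigma> T \<T>] C by (simp add: \<sigma>_def)
  qed simp
  show "1 \<le> evolution_complexity UNIV absorbed_maps T"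
  proof (rule le_evolution_complexityI)
    \<comment> \<open>The root is 2, the least point with a free value; all labels below the first
      step are 0.\<close>
    define \<T> :: "bool list \<Rightarrow> nat" where
      "\<T> s = (if s = [] then 2 else of_bool (s = [True]))" for s
    show "trajectory_tree UNIV T \<T>"
      by (simp add: trajectory_tree_def)
    show "trajectory_shattered absorbed_maps T \<T>"
      unfolding trajectory_shattered_iff
    proof (intro allI impI)
      fix \<sigma> :: "bool list"
      assume len: "length \<sigma> = T"
      then obtain b \<sigma>' where \<sigma>: "\<sigma> = b # \<sigma>'"
        using assms by (cases \<sigma>) auto
      define f :: "nat \<Rightarrow> nat" where "f n = of_bool (n = 2 \<and> b)" for n
      have "f \<in> absorbed_maps"
        by (simp add: absorbed_maps_def f_def)
      moreover have "f (\<T> (take i \<sigma>)) = \<T> (take (Suc i) \<sigma>)" if "i < T" for i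
        using that len \<sigma> by (cases i) (auto simp: \<T>_def f_def)
      ultimately show "\<exists>f\<in>absorbed_maps. \<forall>i<T. f (\<T> (take i \<sigma>)) = \<T> (take (Suc i) \<sigma>)"
        by blast
    qed
    fix \<sigma> :: "bool list"
    have "card {0::nat} \<le> branch_count T \<T> \<sigma>"
      unfolding branch_count_def using assms by (intro card_mono) (auto simp: \<T>_def)
    then show "1 \<le> branch_count T \<T> \<sigma>"
      by simp
  qed
qed

theorem theorem13:
  shows
    "(\<exists>(X :: nat set) F. F \<subseteq> X \<rightarrow>\<^sub>E X \<and> DS_dim X F = \<infinity> \<and>
        (\<lambda>T. real (evolution_complexity X F T)) \<in> \<Theta>(\<lambda>T. ln (real T)))
   \<and> (\<exists>(X :: nat set) F. F \<subseteq> X \<rightarrow>\<^sub>E X \<and> DS_dim X F = 1 \<and>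
        (\<forall>T\<ge>1. evolution_complexity X F T = T))
   \<and> (\<forall>(X :: 'a set) F. X \<noteq> {} \<longrightarrow> F \<noteq> {} \<longrightarrow> F \<subseteq> X \<rightarrow>\<^sub>E X \<longrightarrow>
        (\<forall>T\<ge>1. enat (evolution_complexity X F T) \<le> littlestone_dim X F))
   \<and> (\<exists>(X :: nat set) F. F \<subseteq> X \<rightarrow>\<^sub>E X \<and> littlestone_dim X F = \<infinity> \<and>
        (\<forall>T\<ge>1. evolution_complexity X F T = 1))"
proof (intro conjI)
  have UNIV: "F \<subseteq> UNIV \<rightarrow>\<^sub>E UNIV" for F :: "(nat \<Rightarrow> nat) set"
    by (simp add: PiE_UNIV_domain)
  show "\<exists>(X :: nat set) F. F \<subseteq> X \<rightarrow>\<^sub>E X \<and> DS_dim X F = \<infinity> \<and>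
      (\<lambda>T. real (evolution_complexity X F T)) \<in> \<Theta>(\<lambda>T. ln (real T))"
    by (rule exI[of _ UNIV], rule exI[of _ "dyadic_maps"])
      (simp add: UNIV DS_dim_dyadic_maps evolution_complexity_dyadic_maps)
  show "\<exists>(X :: nat set) F. F \<subseteq> X \<rightarrow>\<^sub>E X \<and> DS_dim X F = 1 \<and> (\<forall>T\<ge>1. evolution_complexity X F T = T)"
    by (rule exI[of _ UNIV], rule exI[of _ "range branch_map"])
      (simp add: UNIV DS_dim_branch_maps evolution_complexity_branch_maps)
  show "\<forall>(X :: 'a set) F. X \<noteq> {} \<longrightarrow> F \<noteq> {} \<longrightarrow> F \<subseteq> X \<rightarrow>\<^sub>E X \<longrightarrow>
      (\<forall>T\<ge>1. enat (evolution_complexity X F T) \<le> littlestone_dim X F)"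
    using evolution_complexity_le_littlestone_dim by blast
  show "\<exists>(X :: nat set) F. F \<subseteq> X \<rightarrow>\<^sub>E X \<and> littlestone_dim X F = \<infinity> \<and>
      (\<forall>T\<ge>1. evolution_complexity X F T = 1)"
    by (rule exI[of _ UNIV], rule exI[of _ "absorbed_maps"])
      (simp add: UNIV littlestone_dim_absorbed_maps evolution_complexity_absorbed_maps)
qed

end
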